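(* Let $(M^n,\mu,\tau,v,g,p)$ be an Aristotelian fluid, $n\ge3$, with speed (squared) $s_v=g(v,v)$, which is a steady flow with Bernoulli function $b\in C^\infty(M^n)$, i.e. $\frac{\partial v}{\partial t}=0$ and $\iota_v\,\mathrm{d}v^\flat=\mathrm{d}b$. Let $\alpha_v=\pounds_v\tau-\mathrm{d}\log s_v$, so that $\mathrm{d}v^\flat=v^\flat\wedge\alpha_v$. If the fluid speed is constant along the fluid lines, i.e. $\pounds_vs_v=0$, then $$\alpha_v=\frac{1}{s_v}\,\mathrm{d}b ,$$ and thus the Godbillon-Vey class $[\alpha_v\wedge\mathrm{d}\alpha_v]\in H^3(M^n;\mathbb{R})$ of the fluid is trivial.
   Context: An ideal incompressible fluid on an oriented $n$-manifold $M^n$ consists of a (time-independent) Riemannian metric $g$ with its Levi-Civita connection $\nabla$, a (time-independent) volume form $\mu$, a smooth one-parameter (time $t$) family of vector fields $v$, and a time-dependent function $p$, such that $\frac{\partial v}{\partial t}+\nabla_vv=-(\mathrm{d}p)^\sharp$ and $\pounds_v\mu=0$ (with $v$ parallel to $\partial M^n$ if the boundary is non-empty). Here $v^\flat=\iota_vg$; fluid lines are the integral curves of $v$. An Aristotelian fluid $(M^n,\mu,\tau,v,g,p)$ is an ideal incompressible fluid together with one-parameter families of a nowhere-vanishing one-form $\tau$ with $\iota_v\tau=1$, a corank one positive-semidefinite symmetric tensor $h\in\Gamma(\odot^2T^*M^n)$ with $\iota_vh=0$, and a corank one positive-semidefinite symmetric tensor $\gamma\in\Gamma(\odot^2TM^n)$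 with $\iota_\tau\gamma=0$, such that $\ker(\tau)$ and $\mathrm{Span}(v)$ are $g$-orthogonal, $h$ restricts to $g$ on $\ker\tau$, $\gamma$ restricts to $g^{-1}$ on $\mathrm{Ann}(v)$, and $\tau\wedge\mathrm{d}\tau=0$. In particular $v$ is nowhere-vanishing and $v^\flat=s_v\,\tau$. The class $[\alpha_v\wedge\mathrm{d}\alpha_v]$ is the Godbillon-Vey class of the foliation tangent to $\ker\tau=\ker v^\flat$. *)

theory Defs
  imports "HOL-Analysis.Analysis"
begin

section \<open>Smooth maps between subsets of normed spaces\<close>

fun Ck_on :: "nat \<Rightarrow> 'a::real_normed_vector set \<Rightarrow> ('a \<Rightarrow> 'b::real_normed_vector) \<Rightarrow> bool" where
  "Ck_on 0 U F \<longleftrightarrow> continuous_on U F"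
| "Ck_on (Suc k) U F \<longleftrightarrow>
     (\<forall>x\<in>U. F differentiable (at x)) \<and> (\<forall>w. Ck_on k U (\<lambda>x. frechet_derivative F (at x) w))"

text \<open>On a set that need not be open, smoothness means that local smooth extensions exist.\<close>

definition smooth_on :: "'a::real_normed_vector set \<Rightarrow> ('a \<Rightarrow> 'b::real_normed_vector) \<Rightarrow> bool" where
  "smooth_on S f \<longleftrightarrow>
     (\<forall>x\<in>S. \<exists>U F. open U \<and> x \<in> U \<and> (\<forall>k. Ck_on k U F) \<and> (\<forall>y\<in>S \<inter> U. F y = f y))"


section \<open>Smooth manifolds with boundary\<close>

text \<open>
  A manifold is a second countable Hausdorff space (the whole type) with a smooth atlas. A chart is
  a pair of its domain and its coordinate map, whose values off the domain are irrelevant. Its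
  image is open in Euclidean space or in one of the coordinate half-spaces.
\<close>

type_synonym ('m, 'n) chart = "'m set \<times> ('m \<Rightarrow> real ^ 'n)"

definition half_space :: "'n::finite \<Rightarrow> (real ^ 'n) set" where
  "half_space i = {x. 0 \<le> x $ i}"

definition chart_inv :: "('m, 'n::finite) chart \<Rightarrow> real ^ 'n \<Rightarrow> 'm" where
  "chart_inv c = inv_into (fst c) (snd c)"

definition chart_image :: "('m, 'n::finite) chart \<Rightarrow> (real ^ 'n) set" where
  "chart_image c = snd c ` fst c"

definition is_chart :: "('m::topological_space, 'n::finite) chart \<Rightarrow> bool" where
  "is_chart c \<longleftrightarrow>
     open (fst c) \<and> homeomorphism (fst c) (chart_image c) (snd c) (chart_inv c) \<and>
     (open (chart_image c) \<or> (\<exists>i. openin (top_of_set (half_space i)) (chart_image c)))"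

definition transition :: "('m, 'n::finite) chart \<Rightarrow> ('m, 'n) chart \<Rightarrow> real ^ 'n \<Rightarrow> real ^ 'n" where
  "transition c c' = snd c' \<circ> chart_inv c"

definition overlap :: "('m, 'n::finite) chart \<Rightarrow> ('m, 'n) chart \<Rightarrow> (real ^ 'n) set" where
  "overlap c c' = snd c ` (fst c \<inter> fst c')"

locale smooth_manifold =
  fixes A :: "('m::{t2_space, second_countable_topology}, 'n::finite) chart set"
  assumes charts: "\<And>c. c \<in> A \<Longrightarrow> is_chart c"
    and cover: "(\<Union>c\<in>A. fst c) = UNIV"
    and compatible: "\<And>c c'. c \<in> A \<Longrightarrow> c' \<in> A \<Longrightarrow> smooth_on (overlap c c') (transition c c')"

locale oriented_manifold = smooth_manifold A
  for A :: "('m::{t2_space, second_countable_topology}, 'n::finite) chart set" +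
  assumes oriented: "\<And>c c' x. c \<in> A \<Longrightarrow> c' \<in> A \<Longrightarrow> x \<in> overlap c c' \<Longrightarrow>
    0 < det (jacobian (transition c c') (at x within overlap c c'))"

definition manifold_boundary :: "('m::topological_space, 'n::finite) chart set \<Rightarrow> 'm set" where
  "manifold_boundary A = {x. \<exists>c\<in>A. \<exists>i. x \<in> fst c \<and>
     openin (top_of_set (half_space i)) (chart_image c) \<and> snd c x $ i = 0}"

definition smooth_functions :: "('m, 'n::finite) chart set \<Rightarrow> ('m \<Rightarrow> real) set" where
  "smooth_functions A = {f. \<forall>c\<in>A. smooth_on (chart_image c) (f \<circ> chart_inv c)}"

text \<open>Smoothness on the product of a time interval \<open>T\<close> and the manifold.\<close>

definition smooth_time_function ::
    "('m, 'n::finite) chart set \<Rightarrow> real set \<Rightarrow> (real \<Rightarrow> 'm \<Rightarrow> real) \<Rightarrow> bool" where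
  "smooth_time_function A T f \<longleftrightarrow>
     (\<forall>c\<in>A. smooth_on (T \<times> chart_image c) (\<lambda>(t, x). f t (chart_inv c x)))"


section \<open>Vector fields, differential forms and symmetric tensors\<close>

text \<open>
  Vector fields are the derivations of the algebra of smooth functions; the value of \<open>X\<close> at a
  point \<open>x\<close> is the tangent vector \<open>\<lambda>f. X f x\<close>. Tensor fields are given by their action on smooth
  fields: they are multilinear, their value at a point depends only on the values of the arguments
  there, and they take smooth fields to smooth functions. A \<open>k\<close>-form takes a list of \<open>k\<close> vector
  fields as its argument, and functions count as \<open>0\<close>-forms. Vector fields and forms are extended
  by \<open>0\<close> to inadmissible arguments, so that equality of such fields is equality in HOL.
\<close>

type_synonym 'm vfield = "('m \<Rightarrow> real) \<Rightarrow> 'm \<Rightarrow> real"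
type_synonym 'm dform = "'m vfield list \<Rightarrow> 'm \<Rightarrow> real"
type_synonym 'm cotensor2 = "'m vfield \<Rightarrow> 'm vfield \<Rightarrow> 'm \<Rightarrow> real"
type_synonym 'm tensor2 = "'m dform \<Rightarrow> 'm dform \<Rightarrow> 'm \<Rightarrow> real"

text \<open>The module structure, common to vector fields and forms.\<close>

definition field_zero :: "'x \<Rightarrow> 'm \<Rightarrow> real" where
  "field_zero = (\<lambda>_ _. 0)"

definition field_add :: "('x \<Rightarrow> 'm \<Rightarrow> real) \<Rightarrow> ('x \<Rightarrow> 'm \<Rightarrow> real) \<Rightarrow> 'x \<Rightarrow> 'm \<Rightarrow> real" where
  "field_add P Q = (\<lambda>a x. P a x + Q a x)"

definition field_diff :: "('x \<Rightarrow> 'm \<Rightarrow> real) \<Rightarrow> ('x \<Rightarrow> 'm \<Rightarrow> real) \<Rightarrow> 'x \<Rightarrow> 'm \<Rightarrow> real" where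
  "field_diff P Q = (\<lambda>a x. P a x - Q a x)"

definition field_scale :: "('m \<Rightarrow> real) \<Rightarrow> ('x \<Rightarrow> 'm \<Rightarrow> real) \<Rightarrow> 'x \<Rightarrow> 'm \<Rightarrow> real" where
  "field_scale f P = (\<lambda>a x. f x * P a x)"

definition value_at :: "('x \<Rightarrow> 'm \<Rightarrow> real) \<Rightarrow> 'm \<Rightarrow> 'x \<Rightarrow> real" where
  "value_at P x = (\<lambda>a. P a x)"

definition vanishes_at :: "('x \<Rightarrow> 'm \<Rightarrow> real) \<Rightarrow> 'm \<Rightarrow> bool" where
  "vanishes_at P x \<longleftrightarrow> value_at P x = (\<lambda>_. 0)"

definition vector_fields :: "('m, 'n::finite) chart set \<Rightarrow> 'm vfield set" where
  "vector_fields A = {X.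
     (\<forall>f. f \<notin> smooth_functions A \<longrightarrow> X f = (\<lambda>_. 0)) \<and>
     (\<forall>f\<in>smooth_functions A. X f \<in> smooth_functions A) \<and>
     (\<forall>f\<in>smooth_functions A. \<forall>h\<in>smooth_functions A.
        X (\<lambda>x. f x + h x) = (\<lambda>x. X f x + X h x) \<and>
        X (\<lambda>x. f x * h x) = (\<lambda>x. X f x * h x + f x * X h x)) \<and>
     (\<forall>f\<in>smooth_functions A. \<forall>c. X (\<lambda>x. c * f x) = (\<lambda>x. c * X f x))}"

definition bracket :: "'m vfield \<Rightarrow> 'm vfield \<Rightarrow> 'm vfield" where
  "bracket X Y = (\<lambda>f x. X (Y f) x - Y (X f) x)"

definition forms :: "('m, 'n::finite) chart set \<Rightarrow> nat \<Rightarrow> 'm dform set" where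
  "forms A k = {\<omega>.
     (\<forall>Xs. \<not> (length Xs = k \<and> set Xs \<subseteq> vector_fields A) \<longrightarrow> \<omega> Xs = (\<lambda>_. 0)) \<and>
     (\<forall>Xs. length Xs = k \<and> set Xs \<subseteq> vector_fields A \<longrightarrow>
        \<omega> Xs \<in> smooth_functions A \<and>
        (\<forall>i<k. \<forall>Y\<in>vector_fields A. \<forall>Z\<in>vector_fields A. \<forall>x. value_at Y x = value_at Z x \<longrightarrow>
           \<omega> (Xs[i := Y]) x = \<omega> (Xs[i := Z]) x) \<and>
        (\<forall>i<k. \<forall>Y\<in>vector_fields A. \<forall>Z\<in>vector_fields A.
           \<omega> (Xs[i := field_add Y Z]) = (\<lambda>x. \<omega> (Xs[i := Y]) x + \<omega> (Xs[i := Z]) x)) \<and>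
        (\<forall>i<k. \<forall>f\<in>smooth_functions A. \<forall>Y\<in>vector_fields A.
           \<omega> (Xs[i := field_scale f Y]) = (\<lambda>x. f x * \<omega> (Xs[i := Y]) x)) \<and>
        (\<forall>i<k. \<forall>j<k. i \<noteq> j \<and> Xs ! i = Xs ! j \<longrightarrow> \<omega> Xs = (\<lambda>_. 0)))}"

definition fun_form :: "('m \<Rightarrow> real) \<Rightarrow> 'm dform" where
  "fun_form f = (\<lambda>Xs. if Xs = [] then f else (\<lambda>_. 0))"

text \<open>The exterior derivative by the invariant formula, in the convention
  \<open>d\<alpha>(X,Y) = X(\<alpha>(Y)) - Y(\<alpha>(X)) - \<alpha>([X,Y])\<close> for 1-forms.\<close>

definition ext_d :: "('m, 'n::finite) chart set \<Rightarrow> 'm dform \<Rightarrow> 'm dform" where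
  "ext_d A \<omega> = (\<lambda>Xs. if set Xs \<subseteq> vector_fields A then
     (\<lambda>x. (\<Sum>i<length Xs. (-1) ^ i * (Xs ! i) (\<omega> (nths Xs (- {i}))) x) +
          (\<Sum>j<length Xs. \<Sum>i<j. (-1) ^ (i + j) *
             \<omega> (bracket (Xs ! i) (Xs ! j) # nths Xs (- {i, j})) x))
     else (\<lambda>_. 0))"

text \<open>The sum over shuffles: \<open>I\<close> is the set of positions whose entries go to the first factor, and
  the sign is that of the shuffle. For 1-forms
  \<open>(\<alpha> \<and> \<beta>)(X,Y) = \<alpha>(X)\<beta>(Y) - \<alpha>(Y)\<beta>(X)\<close>.\<close>

definition wedge :: "('m, 'n::finite) chart set \<Rightarrow> 'm dform \<Rightarrow> 'm dform \<Rightarrow> 'm dform" where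
  "wedge A \<omega> \<eta> = (\<lambda>Xs. if set Xs \<subseteq> vector_fields A then
     (\<lambda>x. \<Sum>I\<in>Pow {..<length Xs}.
        (-1) ^ card {(i, j). i \<in> I \<and> j \<in> {..<length Xs} - I \<and> j < i} *
        \<omega> (nths Xs I) x * \<eta> (nths Xs (- I)) x)
     else (\<lambda>_. 0))"

definition interior_product ::
    "('m, 'n::finite) chart set \<Rightarrow> 'm vfield \<Rightarrow> 'm dform \<Rightarrow> 'm dform" where
  "interior_product A X \<omega> = (\<lambda>Xs. if set Xs \<subseteq> vector_fields A then \<omega> (X # Xs) else (\<lambda>_. 0))"

definition lie_derivative ::
    "('m, 'n::finite) chart set \<Rightarrow> 'm vfield \<Rightarrow> 'm dform \<Rightarrow> 'm dform" where
  "lie_derivative A X \<omega> = (\<lambda>Xs. if set Xs \<subseteq> vector_fields A then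
     (\<lambda>x. X (\<omega> Xs) x - (\<Sum>i<length Xs. \<omega> (Xs[i := bracket X (Xs ! i)]) x))
     else (\<lambda>_. 0))"

text \<open>De Rham cohomology; degree 0 has no nonzero exact forms, since differentials of 0-forms
  that are themselves 0-forms are zero.\<close>

definition closed_forms :: "('m, 'n::finite) chart set \<Rightarrow> nat \<Rightarrow> 'm dform set" where
  "closed_forms A k = {\<omega> \<in> forms A k. ext_d A \<omega> = field_zero}"

definition exact_forms :: "('m, 'n::finite) chart set \<Rightarrow> nat \<Rightarrow> 'm dform set" where
  "exact_forms A k = {\<omega> \<in> forms A k. \<exists>\<eta>\<in>forms A (k - 1). \<omega> = ext_d A \<eta>}"

definition cohomologous :: "('m, 'n::finite) chart set \<Rightarrow> nat \<Rightarrow> ('m dform \<times> 'm dform) set" where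
  "cohomologous A k = {(\<omega>, \<omega>'). \<omega> \<in> closed_forms A k \<and> \<omega>' \<in> closed_forms A k \<and>
     field_diff \<omega> \<omega>' \<in> exact_forms A k}"

definition de_rham :: "('m, 'n::finite) chart set \<Rightarrow> nat \<Rightarrow> 'm dform set set" where
  "de_rham A k = closed_forms A k // cohomologous A k"

definition de_rham_class :: "('m, 'n::finite) chart set \<Rightarrow> nat \<Rightarrow> 'm dform \<Rightarrow> 'm dform set" where
  "de_rham_class A k \<omega> = cohomologous A k `` {\<omega>}"

text \<open>Symmetric 2-tensors on the module \<open>E\<close>: covariant ones for \<open>E = vector_fields A\<close>,
  contravariant ones for \<open>E = forms A 1\<close>.\<close>

definition symmetric_tensor ::
    "('m, 'n::finite) chart set \<Rightarrow> ('x \<Rightarrow> 'm \<Rightarrow> real) set \<Rightarrow>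
     (('x \<Rightarrow> 'm \<Rightarrow> real) \<Rightarrow> ('x \<Rightarrow> 'm \<Rightarrow> real) \<Rightarrow> 'm \<Rightarrow> real) \<Rightarrow> bool" where
  "symmetric_tensor A E B \<longleftrightarrow>
     (\<forall>P\<in>E. \<forall>Q\<in>E. B P Q \<in> smooth_functions A \<and> B P Q = B Q P) \<and>
     (\<forall>P\<in>E. \<forall>Q\<in>E. \<forall>R\<in>E. \<forall>x. value_at P x = value_at Q x \<longrightarrow> B P R x = B Q R x) \<and>
     (\<forall>P\<in>E. \<forall>Q\<in>E. \<forall>R\<in>E. B (field_add P Q) R = (\<lambda>x. B P R x + B Q R x)) \<and>
     (\<forall>f\<in>smooth_functions A. \<forall>P\<in>E. \<forall>R\<in>E. B (field_scale f P) R = (\<lambda>x. f x * B P R x))"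

definition positive_semidefinite ::
    "('x \<Rightarrow> 'm \<Rightarrow> real) set \<Rightarrow>
     (('x \<Rightarrow> 'm \<Rightarrow> real) \<Rightarrow> ('x \<Rightarrow> 'm \<Rightarrow> real) \<Rightarrow> 'm \<Rightarrow> real) \<Rightarrow> bool" where
  "positive_semidefinite E B \<longleftrightarrow> (\<forall>P\<in>E. \<forall>x. 0 \<le> B P P x)"

text \<open>At each point \<open>x\<close> the radical of \<open>B\<close> is the line spanned by the value at \<open>x\<close> of some \<open>K\<close>.\<close>

definition corank_one ::
    "('x \<Rightarrow> 'm \<Rightarrow> real) set \<Rightarrow>
     (('x \<Rightarrow> 'm \<Rightarrow> real) \<Rightarrow> ('x \<Rightarrow> 'm \<Rightarrow> real) \<Rightarrow> 'm \<Rightarrow> real) \<Rightarrow> bool" where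
  "corank_one E B \<longleftrightarrow> (\<forall>x. \<exists>K\<in>E. \<not> vanishes_at K x \<and> (\<forall>Q\<in>E. B K Q x = 0) \<and>
     (\<forall>P\<in>E. (\<forall>Q\<in>E. B P Q x = 0) \<longrightarrow> (\<exists>c. value_at P x = (\<lambda>a. c * value_at K x a))))"


section \<open>Riemannian geometry\<close>

definition riemannian_metric :: "('m, 'n::finite) chart set \<Rightarrow> 'm cotensor2 \<Rightarrow> bool" where
  "riemannian_metric A g \<longleftrightarrow> symmetric_tensor A (vector_fields A) g \<and>
     (\<forall>X\<in>vector_fields A. \<forall>x. \<not> vanishes_at X x \<longrightarrow> 0 < g X X x)"

definition levi_civita ::
    "('m, 'n::finite) chart set \<Rightarrow> 'm cotensor2 \<Rightarrow> ('m vfield \<Rightarrow> 'm vfield \<Rightarrow> 'm vfield) \<Rightarrow> bool"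
    where
  "levi_civita A g nabla \<longleftrightarrow>
     (\<forall>X\<in>vector_fields A. \<forall>Y\<in>vector_fields A. nabla X Y \<in> vector_fields A \<and>
        field_diff (nabla X Y) (nabla Y X) = bracket X Y \<and>
        (\<forall>Z\<in>vector_fields A.
           nabla (field_add X Z) Y = field_add (nabla X Y) (nabla Z Y) \<and>
           nabla X (field_add Y Z) = field_add (nabla X Y) (nabla X Z) \<and>
           X (g Y Z) = (\<lambda>x. g (nabla X Y) Z x + g Y (nabla X Z) x)) \<and>
        (\<forall>f\<in>smooth_functions A.
           nabla (field_scale f X) Y = field_scale f (nabla X Y) \<and>
           nabla X (field_scale f Y) = field_add (field_scale (X f) Y) (field_scale f (nabla X Y))))"

definition flat :: "('m, 'n::finite) chart set \<Rightarrow> 'm cotensor2 \<Rightarrow> 'm vfield \<Rightarrow> 'm dform" where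
  "flat A g X = (\<lambda>Ys. if length Ys = 1 \<and> set Ys \<subseteq> vector_fields A then g X (hd Ys) else (\<lambda>_. 0))"

definition sharp :: "('m, 'n::finite) chart set \<Rightarrow> 'm cotensor2 \<Rightarrow> 'm dform \<Rightarrow> 'm vfield" where
  "sharp A g \<alpha> = (THE X. X \<in> vector_fields A \<and> flat A g X = \<alpha>)"

definition inverse_metric :: "('m, 'n::finite) chart set \<Rightarrow> 'm cotensor2 \<Rightarrow> 'm tensor2" where
  "inverse_metric A g \<alpha> \<beta> = g (sharp A g \<alpha>) (sharp A g \<beta>)"

definition volume_form :: "('m, 'n::finite) chart set \<Rightarrow> 'm dform \<Rightarrow> bool" where
  "volume_form A \<mu> \<longleftrightarrow> \<mu> \<in> forms A CARD('n) \<and> (\<forall>x. \<not> vanishes_at \<mu> x)"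


section \<open>Fluids\<close>

text \<open>Time-dependent vector fields and forms, and the time derivative along an interval \<open>T\<close>.\<close>

definition smooth_family ::
    "('m, 'n::finite) chart set \<Rightarrow> real set \<Rightarrow> ('x \<Rightarrow> 'm \<Rightarrow> real) set \<Rightarrow>
     (real \<Rightarrow> 'x \<Rightarrow> 'm \<Rightarrow> real) \<Rightarrow> bool" where
  "smooth_family A T E P \<longleftrightarrow>
     (\<forall>t\<in>T. P t \<in> E) \<and> (\<forall>a. smooth_time_function A T (\<lambda>t. P t a))"

definition smooth_tensor_family ::
    "('m, 'n::finite) chart set \<Rightarrow> real set \<Rightarrow> ('x \<Rightarrow> 'm \<Rightarrow> real) set \<Rightarrow>
     (real \<Rightarrow> ('x \<Rightarrow> 'm \<Rightarrow> real) \<Rightarrow> ('x \<Rightarrow> 'm \<Rightarrow> real) \<Rightarrow> 'm \<Rightarrow> real) \<Rightarrow> bool" where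
  "smooth_tensor_family A T E B \<longleftrightarrow>
     (\<forall>t\<in>T. symmetric_tensor A E (B t)) \<and>
     (\<forall>P\<in>E. \<forall>Q\<in>E. smooth_time_function A T (\<lambda>t. B t P Q))"

definition time_derivative :: "real set \<Rightarrow> (real \<Rightarrow> 'm vfield) \<Rightarrow> real \<Rightarrow> 'm vfield" where
  "time_derivative T v t = (\<lambda>f x. vector_derivative (\<lambda>s. v s f x) (at t within T))"

text \<open>A vector is tangent to the boundary if it annihilates the functions vanishing there.\<close>

definition parallel_to_boundary ::
    "('m::topological_space, 'n::finite) chart set \<Rightarrow> 'm vfield \<Rightarrow> bool" where
  "parallel_to_boundary A X \<longleftrightarrow>
     (\<forall>f\<in>smooth_functions A. (\<forall>y\<in>manifold_boundary A. f y = 0) \<longrightarrow>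
        (\<forall>x\<in>manifold_boundary A. X f x = 0))"

locale ideal_fluid = oriented_manifold A
  for A :: "('m::{t2_space, second_countable_topology}, 'n::finite) chart set" +
  fixes T :: "real set"
    and \<mu> :: "'m dform"
    and v :: "real \<Rightarrow> 'm vfield"
    and g :: "'m cotensor2"
    and nabla :: "'m vfield \<Rightarrow> 'm vfield \<Rightarrow> 'm vfield"
    and p :: "real \<Rightarrow> 'm \<Rightarrow> real"
  assumes time_interval: "is_interval T" "interior T \<noteq> {}"
    and metric: "riemannian_metric A g"
    and connection: "levi_civita A g nabla"
    and volume: "volume_form A \<mu>"
    and velocity: "smooth_family A T (vector_fields A) v"
    and pressure: "smooth_time_function A T p"
    and euler: "\<And>t. t \<in> T \<Longrightarrow>
      field_add (time_derivative T v t) (nabla (v t) (v t)) =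
      field_scale (\<lambda>_. - 1) (sharp A g (ext_d A (fun_form (p t))))"
    and incompressible: "\<And>t. t \<in> T \<Longrightarrow> lie_derivative A (v t) \<mu> = field_zero"
    and boundary: "\<And>t. t \<in> T \<Longrightarrow> parallel_to_boundary A (v t)"

locale aristotelian_fluid = ideal_fluid A T \<mu> v g nabla p
  for A :: "('m::{t2_space, second_countable_topology}, 'n::finite) chart set"
    and T :: "real set"
    and \<mu> :: "'m dform"
    and \<tau> :: "real \<Rightarrow> 'm dform"
    and v :: "real \<Rightarrow> 'm vfield"
    and g :: "'m cotensor2"
    and nabla :: "'m vfield \<Rightarrow> 'm vfield \<Rightarrow> 'm vfield"
    and p :: "real \<Rightarrow> 'm \<Rightarrow> real" +
  fixes h :: "real \<Rightarrow> 'm cotensor2"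
    and \<gamma> :: "real \<Rightarrow> 'm tensor2"
  assumes clock: "smooth_family A T (forms A 1) \<tau>"
    and clock_nowhere_vanishing: "\<And>t x. t \<in> T \<Longrightarrow> \<not> vanishes_at (\<tau> t) x"
    and clock_normalized: "\<And>t. t \<in> T \<Longrightarrow> interior_product A (v t) (\<tau> t) = fun_form (\<lambda>_. 1)"
    and h_tensor: "smooth_tensor_family A T (vector_fields A) h"
    and h_corank: "\<And>t. t \<in> T \<Longrightarrow> corank_one (vector_fields A) (h t)"
    and h_semidefinite: "\<And>t. t \<in> T \<Longrightarrow> positive_semidefinite (vector_fields A) (h t)"
    and h_velocity: "\<And>t X. t \<in> T \<Longrightarrow> X \<in> vector_fields A \<Longrightarrow> h t (v t) X = (\<lambda>_. 0)"
    and \<gamma>_tensor: "smooth_tensor_family A T (forms A 1) \<gamma>"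
    and \<gamma>_corank: "\<And>t. t \<in> T \<Longrightarrow> corank_one (forms A 1) (\<gamma> t)"
    and \<gamma>_semidefinite: "\<And>t. t \<in> T \<Longrightarrow> positive_semidefinite (forms A 1) (\<gamma> t)"
    and \<gamma>_clock: "\<And>t \<alpha>. t \<in> T \<Longrightarrow> \<alpha> \<in> forms A 1 \<Longrightarrow> \<gamma> t (\<tau> t) \<alpha> = (\<lambda>_. 0)"
    and orthogonal: "\<And>t X x. t \<in> T \<Longrightarrow> X \<in> vector_fields A \<Longrightarrow>
      \<tau> t [X] x = 0 \<Longrightarrow> g (v t) X x = 0"
    and h_restricts: "\<And>t X Y x. t \<in> T \<Longrightarrow> X \<in> vector_fields A \<Longrightarrow> Y \<in> vector_fields A \<Longrightarrow>
      \<tau> t [X] x = 0 \<Longrightarrow> \<tau> t [Y] x = 0 \<Longrightarrow> h t X Y x = g X Y x"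
    and \<gamma>_restricts: "\<And>t \<alpha> \<beta> x. t \<in> T \<Longrightarrow> \<alpha> \<in> forms A 1 \<Longrightarrow> \<beta> \<in> forms A 1 \<Longrightarrow>
      \<alpha> [v t] x = 0 \<Longrightarrow> \<beta> [v t] x = 0 \<Longrightarrow> \<gamma> t \<alpha> \<beta> x = inverse_metric A g \<alpha> \<beta> x"
    and integrable: "\<And>t. t \<in> T \<Longrightarrow> wedge A (\<tau> t) (ext_d A (\<tau> t)) = field_zero"

definition speed :: "'m cotensor2 \<Rightarrow> 'm vfield \<Rightarrow> 'm \<Rightarrow> real" where
  "speed g v = g v v"

definition fluid_alpha ::
    "('m, 'n::finite) chart set \<Rightarrow> 'm cotensor2 \<Rightarrow> 'm dform \<Rightarrow> 'm vfield \<Rightarrow> 'm dform" where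
  "fluid_alpha A g \<tau> v =
     field_diff (lie_derivative A v \<tau>) (ext_d A (fun_form (\<lambda>x. ln (speed g v x))))"

definition steady_with_bernoulli ::
    "('m, 'n::finite) chart set \<Rightarrow> real set \<Rightarrow> 'm cotensor2 \<Rightarrow> (real \<Rightarrow> 'm vfield) \<Rightarrow>
     ('m \<Rightarrow> real) \<Rightarrow> bool" where
  "steady_with_bernoulli A T g v b \<longleftrightarrow> b \<in> smooth_functions A \<and>
     (\<forall>t\<in>T. time_derivative T v t = field_zero \<and>
        interior_product A (v t) (ext_d A (flat A g (v t))) = ext_d A (fun_form b))"

text \<open>The Godbillon-Vey class of the fluid at one instant, in degree 3 de Rham cohomology.\<close>

definition godbillon_vey ::
    "('m, 'n::finite) chart set \<Rightarrow> 'm cotensor2 \<Rightarrow> 'm dform \<Rightarrow> 'm vfield \<Rightarrow> 'm dform set" where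
  "godbillon_vey A g \<tau> v =
     de_rham_class A 3 (wedge A (fluid_alpha A g \<tau> v) (ext_d A (fluid_alpha A g \<tau> v)))"

end

theory Submission
  imports Defs
begin

text \<open>Orthogonality gives \<open>v\<^sup>\<flat> = s \<tau>\<close>, and normalization gives \<open>\<pounds>\<^sub>v \<tau> = \<iota>\<^sub>v d\<tau>\<close>. Evaluating
  \<open>\<tau> \<and> d\<tau> = 0\<close> on \<open>(v, X, Y)\<close> yields \<open>d\<tau> = \<tau> \<and> \<pounds>\<^sub>v \<tau>\<close>, whence \<open>dv\<^sup>\<flat> = v\<^sup>\<flat> \<and> \<alpha>\<close>. When \<open>s\<close> is
  constant along \<open>v\<close>, contracting \<open>d(s \<tau>)\<close> with \<open>v\<close> gives \<open>db = s \<pounds>\<^sub>v \<tau> - ds = s \<alpha>\<close>. Thus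
  \<open>\<alpha> = u db\<close> with \<open>u = 1 / s\<close>, so \<open>\<alpha> \<and> d\<alpha> = u db \<and> du \<and> db\<close> already vanishes as a form.\<close>

section \<open>Closure properties of smooth functions\<close>

lemma Ck_on_cong:
  assumes "open U" "\<And>x. x \<in> U \<Longrightarrow> F x = G x" "Ck_on k U F"
  shows "Ck_on k U G"
  using assms(2,3)
proof (induction k arbitrary: F G)
  case 0
  then show ?case by (simp cong: continuous_on_cong)
next
  case (Suc k)
  have der: "(F has_derivative D) (at x) \<longleftrightarrow> (G has_derivative D) (at x)" if "x \<in> U" for x D
    using that Suc.prems(1) assms(1) has_derivative_transform_within_open[of _ D x UNIV U]
    by metis
  have "G differentiable at x" if "x \<in> U" for x
    using Suc.prems(2) der[OF that] that by (metis Ck_on.simps(2) differentiable_def)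
  moreover have "Ck_on k U (\<lambda>x. frechet_derivative G (at x) w)" for w
  proof (rule Suc.IH)
    show "Ck_on k U (\<lambda>x. frechet_derivative F (at x) w)" using Suc.prems(2) by simp
    \<comment> \<open>\<open>frechet_derivative\<close> is a choice among all derivatives at
      \<open>x\<close>. By \<open>der\<close> the same maps qualify for \<open>F\<close> and
      \<open>G\<close>, so the choices agree.\<close>
    show "frechet_derivative F (at x) w = frechet_derivative G (at x) w" if "x \<in> U" for x
      using der[OF that] by (simp add: frechet_derivative_def)
  qed
  ultimately show ?case by simp
qed

lemma Ck_on_subset:
  assumes "Ck_on k U F" "V \<subseteq> U"
  shows "Ck_on k V F"
  using assms(1)
  by (induction k arbitrary: F) (use assms(2) in \<open>auto intro: continuous_on_subset\<close>)

text \<open>\<open>Ck_on (Suc k)\<close> does not mention continuity of \<open>F\<close> itself. It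
  comes from differentiability at order 0, and the induction carries the descent through the
  derivatives.\<close>

lemma Ck_on_Suc_imp:
  assumes "Ck_on (Suc k) U F"
  shows "Ck_on k U F"
  using assms
proof (induction k arbitrary: F)
  case 0
  then show ?case
    by (auto intro!: differentiable_imp_continuous_on simp: differentiable_on_def
        differentiable_at_withinI)
next
  case (Suc k)
  from Suc.prems[unfolded Ck_on.simps(2)[of "Suc k"]] Suc.IH show ?case
    unfolding Ck_on.simps(2)[of k] by blast
qed

lemma Ck_on_const: "Ck_on k U (\<lambda>_. c)"
  by (induction k arbitrary: c) auto

lemma Ck_on_add:
  assumes "open U" "Ck_on k U F" "Ck_on k U G"
  shows "Ck_on k U (\<lambda>x. F x + G x)"
  using assms(2,3)
proof (induction k arbitrary: F G)
  case 0
  then show ?case by (simp add: continuous_on_add)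
next
  case (Suc k)
  have "Ck_on k U (\<lambda>x. frechet_derivative (\<lambda>x. F x + G x) (at x) w)" for w
  proof (rule Ck_on_cong[OF assms(1)])
    show "Ck_on k U (\<lambda>x. frechet_derivative F (at x) w + frechet_derivative G (at x) w)"
      using Suc by simp
    show "frechet_derivative F (at x) w + frechet_derivative G (at x) w =
        frechet_derivative (\<lambda>x. F x + G x) (at x) w" if "x \<in> U" for x
      using Suc.prems that
        frechet_derivative_at[OF has_derivative_add[of F "frechet_derivative F (at x)" "at x"
            G "frechet_derivative G (at x)"]]
      by (auto simp: frechet_derivative_works dest!: fun_cong[where x = w])
  qed
  then show ?case using Suc.prems by simp
qed

lemma Ck_on_mult:
  fixes F G :: "'a::real_normed_vector \<Rightarrow> real"
  assumes "open U" "Ck_on k U F" "Ck_on k U G"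
  shows "Ck_on k U (\<lambda>x. F x * G x)"
  using assms(2,3)
proof (induction k arbitrary: F G)
  case 0
  then show ?case by (simp add: continuous_on_mult)
next
  case (Suc k)
  have "Ck_on k U (\<lambda>x. frechet_derivative (\<lambda>x. F x * G x) (at x) w)" for w
  proof (rule Ck_on_cong[OF assms(1)])
    \<comment> \<open>Each term of the product rule keeps one factor undifferentiated, so the
      induction hypothesis also needs \<open>F\<close> and \<open>G\<close> themselves in the lower
      class.\<close>
    show "Ck_on k U (\<lambda>x. F x * frechet_derivative G (at x) w + frechet_derivative F (at x) w * G x)"
      using Suc.prems Ck_on_Suc_imp[OF Suc.prems(1)] Ck_on_Suc_imp[OF Suc.prems(2)]
      by (intro Ck_on_add[OF assms(1)] Suc.IH) auto
    fix x assume "x \<in> U"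
    then have "(F has_derivative frechet_derivative F (at x)) (at x)"
      "(G has_derivative frechet_derivative G (at x)) (at x)"
      using Suc.prems by (auto simp flip: frechet_derivative_works)
    from frechet_derivative_at[OF has_derivative_mult[OF this]]
    show "F x * frechet_derivative G (at x) w + frechet_derivative F (at x) w * G x =
        frechet_derivative (\<lambda>x. F x * G x) (at x) w"
      by metis
  qed
  then show ?case using Suc.prems by simp
qed

text \<open>Smoothness of the outer function is given by the sequence \<open>\<phi>\<close> of its derivatives.\<close>

lemma Ck_on_compose_real:
  fixes F :: "'a::real_normed_vector \<Rightarrow> real"
  assumes "open U" "Ck_on k U F" "\<And>x. x \<in> U \<Longrightarrow> F x \<in> J"
    and der: "\<And>n y. y \<in> J \<Longrightarrow> (\<phi> n has_real_derivative \<phi> (Suc n) y) (at y)"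
  shows "Ck_on k U (\<lambda>x. \<phi> n (F x))"
  using assms(2)
\<comment> \<open>Each differentiation lowers \<open>k\<close> and replaces \<phi> \<open>n\<close>
  by \<phi> \<open>(Suc n)\<close>, hence the generalization over \<open>n\<close>.\<close>
proof (induction k arbitrary: n)
  case 0
  have "isCont (\<phi> n) y" if "y \<in> J" for y
    using der[OF that] by (rule DERIV_isCont)
  moreover have "isCont F x" if "x \<in> U" for x
    using 0 assms(1) that by (simp add: continuous_on_eq_continuous_at)
  ultimately show ?case
    using assms(1,3) by (auto simp: continuous_on_eq_continuous_at intro: isCont_o2)
next
  case (Suc k)
  have hd: "((\<lambda>x. \<phi> n (F x)) has_derivative
      (\<lambda>w. frechet_derivative F (at x) w * \<phi> (Suc n) (F x))) (at x)" if "x \<in> U" for x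
  proof -
    have "(F has_derivative frechet_derivative F (at x)) (at x)"
      using Suc.prems that by (auto simp flip: frechet_derivative_works)
    from has_derivative_compose[OF this der[OF assms(3)[OF that], unfolded has_field_derivative_def]]
    show ?thesis by (simp add: mult.commute)
  qed
  have "Ck_on k U (\<lambda>x. frechet_derivative (\<lambda>x. \<phi> n (F x)) (at x) w)" for w
  proof (rule Ck_on_cong[OF assms(1)])
    show "Ck_on k U (\<lambda>x. frechet_derivative F (at x) w * \<phi> (Suc n) (F x))"
      using Suc.prems Ck_on_Suc_imp[OF Suc.prems] by (intro Ck_on_mult[OF assms(1)] Suc.IH) auto
    show "frechet_derivative F (at x) w * \<phi> (Suc n) (F x) =
        frechet_derivative (\<lambda>x. \<phi> n (F x)) (at x) w" if "x \<in> U" for x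
      using frechet_derivative_at[OF hd[OF that]] by metis
  qed
  then show ?case using hd by (auto simp: differentiable_def)
qed

section \<open>Smoothness on arbitrary sets through local extensions\<close>

lemma smooth_on_const: "smooth_on S (\<lambda>_. c)"
  unfolding smooth_on_def using Ck_on_const by (metis UNIV_I open_UNIV)

lemma smooth_on_add:
  assumes "smooth_on S f" "smooth_on S h"
  shows "smooth_on S (\<lambda>x. f x + h x)"
  unfolding smooth_on_def
proof
  fix x assume "x \<in> S"
  then obtain U F V H where
    "open U" "x \<in> U" "\<And>k. Ck_on k U F" "\<And>y. y \<in> S \<inter> U \<Longrightarrow> F y = f y"
    "open V" "x \<in> V" "\<And>k. Ck_on k V H" "\<And>y. y \<in> S \<inter> V \<Longrightarrow> H y = h y"
    using assms unfolding smooth_on_def by metis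
  then show "\<exists>U F. open U \<and> x \<in> U \<and> (\<forall>k. Ck_on k U F) \<and> (\<forall>y\<in>S \<inter> U. F y = f y + h y)"
    by (intro exI[of _ "U \<inter> V"] exI[of _ "\<lambda>x. F x + H x"])
      (auto intro!: Ck_on_add intro: Ck_on_subset)
qed

lemma smooth_on_mult:
  fixes f h :: "'a::real_normed_vector \<Rightarrow> real"
  assumes "smooth_on S f" "smooth_on S h"
  shows "smooth_on S (\<lambda>x. f x * h x)"
  unfolding smooth_on_def
proof
  fix x assume "x \<in> S"
  then obtain U F V H where
    "open U" "x \<in> U" "\<And>k. Ck_on k U F" "\<And>y. y \<in> S \<inter> U \<Longrightarrow> F y = f y"
    "open V" "x \<in> V" "\<And>k. Ck_on k V H" "\<And>y. y \<in> S \<inter> V \<Longrightarrow> H y = h y"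
    using assms unfolding smooth_on_def by metis
  then show "\<exists>U F. open U \<and> x \<in> U \<and> (\<forall>k. Ck_on k U F) \<and> (\<forall>y\<in>S \<inter> U. F y = f y * h y)"
    by (intro exI[of _ "U \<inter> V"] exI[of _ "\<lambda>x. F x * H x"])
      (auto intro!: Ck_on_mult intro: Ck_on_subset)
qed

lemma smooth_on_compose_real:
  fixes f :: "'a::real_normed_vector \<Rightarrow> real"
  assumes "smooth_on S f" "\<And>x. x \<in> S \<Longrightarrow> f x \<in> J" "open J"
    and "\<And>n y. y \<in> J \<Longrightarrow> (\<phi> n has_real_derivative \<phi> (Suc n) y) (at y)"
  shows "smooth_on S (\<lambda>x. \<phi> n (f x))"
  unfolding smooth_on_def
proof
  fix x assume x: "x \<in> S"
  then obtain U F where U: "open U" "x \<in> U" "\<And>k. Ck_on k U F" "\<And>y. y \<in> S \<inter> U \<Longrightarrow> F y = f y"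
    using assms(1) unfolding smooth_on_def by metis
  \<comment> \<open>Away from \<open>S\<close> the extension \<open>F\<close> may leave
    \<open>J\<close>, where nothing is known about \<phi>, so its domain is shrunk to the preimage
    of \<open>J\<close>.\<close>
  define V where "V = U \<inter> F -` J"
  have "continuous_on U F" using U(3)[of 0] by simp
  then have "open V" unfolding V_def using U(1) assms(3) by (rule continuous_open_preimage)
  moreover have "x \<in> V" using U x assms(2) by (simp add: V_def)
  moreover have "Ck_on k V (\<lambda>x. \<phi> n (F x))" for k
    by (rule Ck_on_compose_real[where J = J])
      (use \<open>open V\<close> assms(4) in \<open>auto simp: V_def intro: Ck_on_subset[OF U(3)]\<close>)
  ultimately show "\<exists>U F. open U \<and> x \<in> U \<and> (\<forall>k. Ck_on k U F) \<and> (\<forall>y\<in>S \<inter> U. F y = \<phi> n (f y))"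
    using U(4) by (intro exI[of _ V] exI[of _ "\<lambda>x. \<phi> n (F x)"]) (auto simp: V_def)
qed

section \<open>Smooth functions on the manifold\<close>

lemma smooth_functions_const: "(\<lambda>_. c) \<in> smooth_functions A"
  by (simp add: smooth_functions_def o_def smooth_on_const)

lemma smooth_functions_add:
  "f \<in> smooth_functions A \<Longrightarrow> h \<in> smooth_functions A \<Longrightarrow> (\<lambda>x. f x + h x) \<in> smooth_functions A"
  by (simp add: smooth_functions_def o_def smooth_on_add)

lemma smooth_functions_mult:
  "f \<in> smooth_functions A \<Longrightarrow> h \<in> smooth_functions A \<Longrightarrow> (\<lambda>x. f x * h x) \<in> smooth_functions A"
  by (simp add: smooth_functions_def o_def smooth_on_mult)

lemma smooth_functions_minus:
  "f \<in> smooth_functions A \<Longrightarrow> (\<lambda>x. - f x) \<in> smooth_functions A"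
  using smooth_functions_mult[OF smooth_functions_const[of "- 1"]] by fastforce

lemma smooth_functions_diff:
  "f \<in> smooth_functions A \<Longrightarrow> h \<in> smooth_functions A \<Longrightarrow> (\<lambda>x. f x - h x) \<in> smooth_functions A"
  using smooth_functions_add[OF _ smooth_functions_minus] by fastforce

lemma smooth_functions_compose_real:
  assumes "f \<in> smooth_functions A" "\<And>x. f x \<in> J" "open J"
    and "\<And>n y. y \<in> J \<Longrightarrow> (\<phi> n has_real_derivative \<phi> (Suc n) y) (at y)"
  shows "(\<lambda>x. \<phi> n (f x)) \<in> smooth_functions A"
  unfolding smooth_functions_def
proof (intro CollectI ballI)
  fix c assume "c \<in> A"
  then have "smooth_on (chart_image c) (f \<circ> chart_inv c)"
    using assms(1) by (simp add: smooth_functions_def)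
  from smooth_on_compose_real[where J = J and \<phi> = \<phi> and n = n, OF this _ assms(3,4)] assms(2)
  show "smooth_on (chart_image c) ((\<lambda>x. \<phi> n (f x)) \<circ> chart_inv c)"
    by (simp add: o_def)
qed

lemma smooth_functions_exp:
  "f \<in> smooth_functions A \<Longrightarrow> (\<lambda>x. exp (f x)) \<in> smooth_functions A"
  by (rule smooth_functions_compose_real[where J = UNIV and \<phi> = "\<lambda>_. exp"]) (auto intro: DERIV_exp)

lemma smooth_functions_ln:
  assumes "f \<in> smooth_functions A" "\<And>x. f x > 0"
  shows "(\<lambda>x. ln (f x)) \<in> smooth_functions A"
proof -
  \<comment> \<open>The successive derivatives of ln on the positive reals: the one of order m + 1
    is (-1)^m m! / y^(m+1).\<close>
  define \<phi> where "\<phi> n y = (case n of 0 \<Rightarrow> ln y | Suc m \<Rightarrow> (-1) ^ m * fact m * inverse (y ^ Suc m))"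
    for n and y :: real
  have "(\<phi> n has_real_derivative \<phi> (Suc n) y) (at y)" if "y \<in> {0<..}" for n y
  proof (cases n)
    case 0
    then show ?thesis using that DERIV_ln[of y] by (simp add: \<phi>_def[abs_def])
  next
    case (Suc m)
    have "((\<lambda>y. (-1) ^ m * fact m * inverse (y ^ Suc m)) has_real_derivative
        (-1) ^ Suc m * fact (Suc m) * inverse (y ^ Suc (Suc m))) (at y)"
      by (rule derivative_eq_intros refl | use that in \<open>simp add: field_simps\<close>)+
    then show ?thesis by (simp add: \<phi>_def[abs_def] Suc)
  qed
  from smooth_functions_compose_real[where \<phi> = \<phi> and J = "{0<..}" and n = 0, OF assms(1) _ _ this]
  show ?thesis using assms(2) by (simp add: \<phi>_def)
qed

text \<open>Since 1 / f = exp (- ln f), no separate derivative sequence for the reciprocal is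
  required.\<close>

lemma smooth_functions_inverse:
  assumes "f \<in> smooth_functions A" "\<And>x. f x > 0"
  shows "(\<lambda>x. 1 / f x) \<in> smooth_functions A"
  using smooth_functions_exp[OF smooth_functions_minus[OF smooth_functions_ln[OF assms]]] assms(2)
  by (simp add: exp_minus inverse_eq_divide)


section \<open>Vector fields as derivations\<close>

lemma vector_field_smooth:
  "X \<in> vector_fields A \<Longrightarrow> f \<in> smooth_functions A \<Longrightarrow> X f \<in> smooth_functions A"
  by (simp add: vector_fields_def)

lemma vector_field_off:
  "X \<in> vector_fields A \<Longrightarrow> f \<notin> smooth_functions A \<Longrightarrow> X f = (\<lambda>_. 0)"
  by (simp add: vector_fields_def)

lemma vector_field_add:
  "X \<in> vector_fields A \<Longrightarrow> f \<in> smooth_functions A \<Longrightarrow> h \<in> smooth_functions A \<Longrightarrow>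
    X (\<lambda>x. f x + h x) = (\<lambda>x. X f x + X h x)"
  by (simp add: vector_fields_def)

lemma vector_field_mult:
  "X \<in> vector_fields A \<Longrightarrow> f \<in> smooth_functions A \<Longrightarrow> h \<in> smooth_functions A \<Longrightarrow>
    X (\<lambda>x. f x * h x) = (\<lambda>x. X f x * h x + f x * X h x)"
  by (simp add: vector_fields_def)

lemma vector_field_cmult:
  "X \<in> vector_fields A \<Longrightarrow> f \<in> smooth_functions A \<Longrightarrow> X (\<lambda>x. c * f x) = (\<lambda>x. c * X f x)"
  by (simp add: vector_fields_def)

text \<open>The product rule on 1 * 1 = 1 reads X(1) = 2 X(1), so X(1) = 0. Homogeneity extends this
  to every constant.\<close>

lemma vector_field_const:
  assumes "X \<in> vector_fields A"
  shows "X (\<lambda>_. c) = (\<lambda>_. 0)"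
proof -
  have "X (\<lambda>_. 1) x = 0" for x
    using fun_cong[OF vector_field_mult[OF assms smooth_functions_const smooth_functions_const], of 1 1 x]
    by simp
  then show ?thesis
    using vector_field_cmult[OF assms smooth_functions_const, of c 1] by simp
qed

lemma vector_fields_field_scale:
  assumes "u \<in> smooth_functions A" "X \<in> vector_fields A"
  shows "field_scale u X \<in> vector_fields A"
  unfolding vector_fields_def field_scale_def
  using assms by (auto simp: vector_field_off vector_field_smooth vector_field_add vector_field_mult
      vector_field_cmult smooth_functions_mult algebra_simps)

lemma vector_fields_field_add:
  assumes "X \<in> vector_fields A" "Y \<in> vector_fields A"
  shows "field_add X Y \<in> vector_fields A"
  unfolding vector_fields_def field_add_def
  using assms by (auto simp: vector_field_off vector_field_smooth vector_field_add vector_field_mult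
      vector_field_cmult smooth_functions_add algebra_simps)

text \<open>The mixed terms X(f) Y(h) + Y(f) X(h) in the second-order product rule are symmetric in
  \<open>X\<close> and \<open>Y\<close>, so they cancel in the commutator. Off the smooth functions
  each composite applies a field to the zero function.\<close>

lemma vector_fields_bracket:
  assumes "X \<in> vector_fields A" "Y \<in> vector_fields A"
  shows "bracket X Y \<in> vector_fields A"
proof -
  note rules = vector_field_off[OF assms(1)] vector_field_off[OF assms(2)]
    vector_field_const[OF assms(1)] vector_field_const[OF assms(2)]
    vector_field_smooth[OF assms(1)] vector_field_smooth[OF assms(2)]
    vector_field_add[OF assms(1)] vector_field_add[OF assms(2)]
    vector_field_mult[OF assms(1)] vector_field_mult[OF assms(2)]
    vector_field_cmult[OF assms(1)] vector_field_cmult[OF assms(2)]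
    smooth_functions_add smooth_functions_diff smooth_functions_mult
  show ?thesis
    unfolding vector_fields_def bracket_def by (auto simp: rules) (simp_all add: algebra_simps)
qed

text \<open>Derivations are defined algebraically, so the chain rule needs Hadamard's factorization
  \<open>exp y - 1 = y * E y\<close> with \<open>E\<close> smooth.\<close>

lemma exp_Hadamard:
  obtains E :: "nat \<Rightarrow> real \<Rightarrow> real" where
    "\<And>n y. (E n has_real_derivative E (Suc n) y) (at y)"
    "\<And>y. exp y - 1 = y * E 0 y" "E 0 0 = 1"
proof
  \<comment> \<open>The coefficients 1 / (k+1)! are those of (exp y - 1) / y. \<open>diffs\<close>
    differentiates coefficient sequences, so \<open>E n\<close> is the n-th derivative of that
    series.\<close>
  define c :: "nat \<Rightarrow> nat \<Rightarrow> real" where "c n = (diffs ^^ n) (\<lambda>k. 1 / fact (Suc k))" for n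
  define E where "E n y = (\<Sum>k. c n k * y ^ k)" for n y
  have exp: "(\<lambda>k. y ^ Suc k / fact (Suc k)) sums (exp y - 1)" for y :: real
    using exp_converges[of y] sums_Suc_iff[of "\<lambda>k. y ^ k / fact k" "exp y - 1"]
    by (simp add: divide_inverse mult.commute)
  have summ: "summable (\<lambda>k. c n k * y ^ k)" for n y
  proof (induction n arbitrary: y)
    case 0
    have "summable (\<lambda>k. 1 / fact (Suc k) * y ^ k)"
    \<comment> \<open>For nonzero y the series is the one in \<open>exp\<close> divided by y; at y =
      0 only its constant term survives.\<close>
    proof (cases "y = 0")
      case True
      then show ?thesis by (simp only: summable_0_powser)
    next
      case False
      show ?thesis
        using summable_mult[OF sums_summable[OF exp[of y]], of "1 / y"] False by simp
    qed
    then show ?case by (simp add: c_def)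
  next
    case (Suc n)
    then show ?case using termdiff_converges_all[of "c n"] by (simp add: c_def)
  qed
  show "(E n has_real_derivative E (Suc n) y) (at y)" for n y
    using termdiffs_strong_converges_everywhere[of "c n" y, OF summ] by (simp add: E_def[abs_def] c_def)
  show "exp y - 1 = y * E 0 y" for y
    using suminf_mult[OF summ[of 0 y], of y] sums_unique[OF exp[of y]]
    by (simp add: E_def c_def mult.commute)
  show "E 0 0 = 1" using powser_zero[of "c 0"] by (simp only: E_def) (simp add: c_def)
qed

text \<open>Around the fixed point \<open>x\<close> write exp f = exp (f x) * (1 + F * E(F)) with F
  = f - f x. Since F vanishes at \<open>x\<close> and E(0) = 1, the product rule leaves only X(F)
  there, which equals X(f).\<close>

lemma vector_field_exp:
  assumes X: "X \<in> vector_fields A" and f: "f \<in> smooth_functions A"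
  shows "X (\<lambda>x. exp (f x)) x = exp (f x) * X f x"
proof -
  obtain E :: "nat \<Rightarrow> real \<Rightarrow> real" where
    E: "\<And>n y. (E n has_real_derivative E (Suc n) y) (at y)"
    "\<And>y. exp y - 1 = y * E 0 y" "E 0 0 = 1"
    using exp_Hadamard by blast
  define F where "F y = f y - f x" for y
  have F: "F \<in> smooth_functions A"
    unfolding F_def by (intro smooth_functions_diff f smooth_functions_const)
  have EF: "(\<lambda>y. E 0 (F y)) \<in> smooth_functions A"
    by (rule smooth_functions_compose_real[where J = UNIV and \<phi> = E, OF F]) (use E in auto)
  have XF: "X F x = X f x"
    using vector_field_add[OF X f smooth_functions_const, of "- f x"]
    by (simp add: F_def[abs_def] vector_field_const[OF X])
  have "(\<lambda>y. exp (f y)) = (\<lambda>y. exp (f x) * (1 + F y * E 0 (F y)))"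
  proof
    show "exp (f y) = exp (f x) * (1 + F y * E 0 (F y))" for y
      using E(2)[of "F y"] exp_add[of "f x" "F y"] by (simp add: F_def)
  qed
  then have "X (\<lambda>y. exp (f y)) x = X (\<lambda>y. exp (f x) * (1 + F y * E 0 (F y))) x"
    by (rule arg_cong[THEN fun_cong])
  also have "\<dots> = exp (f x) * (X F x * E 0 (F x) + F x * X (\<lambda>y. E 0 (F y)) x)"
    by (simp add: vector_field_cmult[OF X] vector_field_add[OF X] vector_field_mult[OF X]
        vector_field_const[OF X] smooth_functions_const smooth_functions_add smooth_functions_mult F EF)
  finally show ?thesis using E(3) XF by (simp add: F_def)
qed

text \<open>Apply \<open>vector_field_exp\<close> to ln f: the left side becomes X(f), and the
  factor exp (ln f) = f can be divided out.\<close>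

lemma vector_field_ln:
  assumes "X \<in> vector_fields A" "f \<in> smooth_functions A" "\<And>x. f x > 0"
  shows "X (\<lambda>x. ln (f x)) x = X f x / f x"
  using vector_field_exp[OF assms(1) smooth_functions_ln[OF assms(2,3)], of x] assms(3)
  by (simp add: less_imp_neq[symmetric])

section \<open>Forms\<close>

text \<open>Each term of the invariant formula feeds \<omega> one argument fewer: either one field
  is removed, or two are replaced by their bracket. Fields applied to the resulting zero functions
  give zero.\<close>

lemma ext_d_eq_0_off_degree:
  assumes "\<And>Xs. length Xs \<noteq> k \<Longrightarrow> \<omega> Xs = (\<lambda>_. 0)" "length Xs \<noteq> Suc k"
  shows "ext_d A \<omega> Xs = (\<lambda>_. 0)"
proof (cases "set Xs \<subseteq> vector_fields A")
  case True
  have l1: "length (nths Xs (- {i})) \<noteq> k" if "i < length Xs" for i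
  proof -
    have "{j. j < length Xs \<and> j \<noteq> i} = {..<length Xs} - {i}" by auto
    then show ?thesis using that assms(2) by (simp add: length_nths)
  qed
  have l2: "Suc (length (nths Xs (- {i, j}))) \<noteq> k" if "i < j" "j < length Xs" for i j
  proof -
    have "{l. l < length Xs \<and> l \<noteq> i \<and> l \<noteq> j} = {..<length Xs} - {i, j}" by auto
    then show ?thesis using that assms(2) by (simp add: length_nths)
  qed
  have "(Xs ! i) (\<omega> (nths Xs (- {i}))) x = 0" if "i < length Xs" for i x
    using assms(1)[OF l1[OF that]] vector_field_const[of "Xs ! i" A 0] True that
    by (simp add: nth_mem subset_iff)
  moreover have "\<omega> (bracket (Xs ! i) (Xs ! j) # nths Xs (- {i, j})) x = 0"
    if "i < j" "j < length Xs" for i j x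
    using assms(1) l2[OF that] by simp
  ultimately show ?thesis by (simp add: ext_d_def)
qed (simp add: ext_d_def)

lemma ext_d_fun_form:
  "ext_d A (fun_form f) Xs =
    (if length Xs = 1 \<and> set Xs \<subseteq> vector_fields A then hd Xs f else (\<lambda>_. 0))"
proof (cases "length Xs = 1")
  case True
  then obtain X where "Xs = [X]" by (auto simp: length_Suc_conv)
  then show ?thesis by (auto simp: ext_d_def fun_form_def nths_Cons)
next
  case False
  then show ?thesis
    using ext_d_eq_0_off_degree[of 0 "fun_form f" Xs A] by (simp add: fun_form_def)
qed

lemma ext_d_one_form:
  assumes "X \<in> vector_fields A" "Y \<in> vector_fields A"
  shows "ext_d A \<omega> [X, Y] = (\<lambda>x. X (\<omega> [Y]) x - Y (\<omega> [X]) x - \<omega> [bracket X Y] x)"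
  using assms by (auto simp: ext_d_def nths_Cons numeral_2_eq_2)

text \<open>Only the singletons \<open>I\<close> contribute to the shuffle sum, and \<open>{k}\<close> has \<open>k\<close> inversions.\<close>

lemma wedge_one_form:
  assumes "\<And>Xs. length Xs \<noteq> 1 \<Longrightarrow> \<omega> Xs = (\<lambda>_. 0)" "set Xs \<subseteq> vector_fields A"
  shows "wedge A \<omega> \<eta> Xs x = (\<Sum>k<length Xs. (-1) ^ k * \<omega> [Xs ! k] x * \<eta> (nths Xs (- {k})) x)"
proof -
  define n where "n = length Xs"
  define s :: "nat set \<Rightarrow> real" where
    "s I = (-1) ^ card {(i, j). i \<in> I \<and> j \<in> {..<n} - I \<and> j < i}" for I
  have nths: "nths Xs {k} = [Xs ! k]" if "k < n" for k
    using that unfolding n_def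
    by (induction Xs arbitrary: k) (auto simp: nths_Cons nth_Cons split: nat.splits)
  have "s {k} = (-1) ^ k" if "k < n" for k
  proof -
    have "{(i, j). i \<in> {k} \<and> j \<in> {..<n} - {k} \<and> j < i} = {k} \<times> {..<k}"
      using that by auto
    then show ?thesis by (simp add: s_def)
  qed
  moreover have "\<omega> (nths Xs I) x = 0" if "I \<in> Pow {..<n} - (\<lambda>k. {k}) ` {..<n}" for I
  proof -
    have "{i. i < length Xs \<and> i \<in> I} = I" using that by (auto simp: n_def)
    moreover have "card I \<noteq> 1" using that by (auto simp: card_1_singleton_iff)
    ultimately show ?thesis using assms(1) by (simp add: length_nths)
  qed
  ultimately have "(\<Sum>I\<in>Pow {..<n}. s I * \<omega> (nths Xs I) x * \<eta> (nths Xs (- I)) x) =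
      (\<Sum>k<n. (-1) ^ k * \<omega> [Xs ! k] x * \<eta> (nths Xs (- {k})) x)"
    by (subst sum.mono_neutral_right[of _ "(\<lambda>k. {k}) ` {..<n}"])
      (auto simp: sum.reindex nths)
  then show ?thesis using assms(2) by (simp add: wedge_def s_def n_def)
qed

text \<open>In the expansion \<open>wedge_one_form\<close> the factor \<eta> always receives all
  arguments but one, which is the wrong number unless there are k + 1 of them.\<close>

lemma wedge_one_form_eq_0_off_degree:
  assumes "\<And>Xs. length Xs \<noteq> 1 \<Longrightarrow> \<omega> Xs = (\<lambda>_. 0)" "\<And>Xs. length Xs \<noteq> k \<Longrightarrow> \<eta> Xs = (\<lambda>_. 0)"
    "length Xs \<noteq> Suc k"
  shows "wedge A \<omega> \<eta> Xs = (\<lambda>_. 0)"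
proof (cases "set Xs \<subseteq> vector_fields A")
  case True
  have "\<eta> (nths Xs (- {i})) = (\<lambda>_. 0)" if "i < length Xs" for i
  proof (rule assms(2))
    have "{j. j < length Xs \<and> j \<noteq> i} = {..<length Xs} - {i}" by auto
    then show "length (nths Xs (- {i})) \<noteq> k" using that assms(3) by (simp add: length_nths)
  qed
  moreover have "wedge A \<omega> \<eta> Xs x =
      (\<Sum>k<length Xs. (-1) ^ k * \<omega> [Xs ! k] x * \<eta> (nths Xs (- {k})) x)" for x
    using assms(1) True by (rule wedge_one_form)
  ultimately show ?thesis by (simp add: fun_eq_iff)
qed (simp add: wedge_def)

lemma wedge_one_one:
  assumes "\<And>Xs. length Xs \<noteq> 1 \<Longrightarrow> \<omega> Xs = (\<lambda>_. 0)" "X \<in> vector_fields A" "Y \<in> vector_fields A"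
  shows "wedge A \<omega> \<eta> [X, Y] x = \<omega> [X] x * \<eta> [Y] x - \<omega> [Y] x * \<eta> [X] x"
proof -
  have "wedge A \<omega> \<eta> [X, Y] x =
      (\<Sum>k<length [X, Y]. (-1) ^ k * \<omega> [[X, Y] ! k] x * \<eta> (nths [X, Y] (- {k})) x)"
    by (rule wedge_one_form) (use assms in simp_all)
  then show ?thesis by (simp add: nths_Cons)
qed

lemma wedge_one_two:
  assumes "\<And>Xs. length Xs \<noteq> 1 \<Longrightarrow> \<omega> Xs = (\<lambda>_. 0)"
    "X \<in> vector_fields A" "Y \<in> vector_fields A" "Z \<in> vector_fields A"
  shows "wedge A \<omega> \<eta> [X, Y, Z] x =
    \<omega> [X] x * \<eta> [Y, Z] x - \<omega> [Y] x * \<eta> [X, Z] x + \<omega> [Z] x * \<eta> [X, Y] x"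
proof -
  have "wedge A \<omega> \<eta> [X, Y, Z] x =
      (\<Sum>k<length [X, Y, Z]. (-1) ^ k * \<omega> [[X, Y, Z] ! k] x * \<eta> (nths [X, Y, Z] (- {k})) x)"
    by (rule wedge_one_form) (use assms in simp_all)
  then show ?thesis by (simp add: nths_Cons)
qed

section \<open>One-forms, the zero class and the vanishing of decomposable forms\<close>

lemma one_form_off:
  "\<omega> \<in> forms A 1 \<Longrightarrow> \<not> (length Xs = 1 \<and> set Xs \<subseteq> vector_fields A) \<Longrightarrow> \<omega> Xs = (\<lambda>_. 0)"
  unfolding forms_def mem_Collect_eq by (elim conjE) blast

lemma one_form_smooth:
  assumes "\<omega> \<in> forms A 1" "X \<in> vector_fields A"
  shows "\<omega> [X] \<in> smooth_functions A"
proof -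
  have "\<forall>Xs. length Xs = 1 \<and> set Xs \<subseteq> vector_fields A \<longrightarrow> \<omega> Xs \<in> smooth_functions A"
    using assms(1) unfolding forms_def mem_Collect_eq by blast
  then show ?thesis using assms(2) by simp
qed

lemma one_form_linear:
  assumes "\<omega> \<in> forms A 1"
  shows one_form_local: "\<And>Y Z x. Y \<in> vector_fields A \<Longrightarrow> Z \<in> vector_fields A \<Longrightarrow>
      value_at Y x = value_at Z x \<Longrightarrow> \<omega> [Y] x = \<omega> [Z] x"
    and one_form_add: "\<And>Y Z. Y \<in> vector_fields A \<Longrightarrow> Z \<in> vector_fields A \<Longrightarrow>
      \<omega> [field_add Y Z] = (\<lambda>x. \<omega> [Y] x + \<omega> [Z] x)"
    and one_form_scale: "\<And>f Y. f \<in> smooth_functions A \<Longrightarrow> Y \<in> vector_fields A \<Longrightarrow>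
      \<omega> [field_scale f Y] = (\<lambda>x. f x * \<omega> [Y] x)"
proof -
  \<comment> \<open>The clauses of \<open>forms\<close> speak of updating one slot of an admissible
    list. With the list \<open>[X]\<close> and slot 0, the update by \<open>Y\<close> is just
    \<open>[Y]\<close>.\<close>
  have in_list: "length [X] = 1 \<and> set [X] \<subseteq> vector_fields A" if "X \<in> vector_fields A" for X
    using that by simp
  note * = assms[unfolded forms_def mem_Collect_eq, THEN conjunct2, THEN spec, THEN mp,
      OF in_list, THEN conjunct2]
  show "\<omega> [Y] x = \<omega> [Z] x"
    if "Y \<in> vector_fields A" "Z \<in> vector_fields A" "value_at Y x = value_at Z x" for Y Z x
    using *[OF that(1), THEN conjunct1, rule_format, OF zero_less_one that] by simp
  show "\<omega> [field_add Y Z] = (\<lambda>x. \<omega> [Y] x + \<omega> [Z] x)"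
    if "Y \<in> vector_fields A" "Z \<in> vector_fields A" for Y Z
    using *[OF that(1), THEN conjunct2, THEN conjunct1, rule_format, OF zero_less_one that] by simp
  show "\<omega> [field_scale f Y] = (\<lambda>x. f x * \<omega> [Y] x)"
    if "f \<in> smooth_functions A" "Y \<in> vector_fields A" for f Y
    using *[OF that(2), THEN conjunct2, THEN conjunct2, THEN conjunct1, rule_format,
        OF zero_less_one that] by simp
qed

text \<open>Closedness makes the class of the zero form an actual element of the quotient
  \<open>de_rham\<close>.\<close>

lemma field_zero_closed: "field_zero \<in> closed_forms A k"
proof -
  have "ext_d A field_zero = field_zero"
  proof
    fix Xs :: "('a vfield) list"
    have "(Xs ! i) (\<lambda>_. 0) x = 0" if "set Xs \<subseteq> vector_fields A" "i < length Xs" for i x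
      using vector_field_const[of "Xs ! i" A 0] that by (simp add: nth_mem subset_iff)
    then show "ext_d A field_zero Xs = field_zero Xs"
      by (auto simp: ext_d_def field_zero_def fun_eq_iff)
  qed
  then show ?thesis
    by (simp add: closed_forms_def forms_def field_zero_def smooth_functions_const)
qed

text \<open>On three fields the expansion is u times a determinant with rows db, du, db, and two
  equal rows make it vanish.\<close>

lemma wedge_ext_d_scaled_differential:
  assumes u: "u \<in> smooth_functions A" and b: "b \<in> smooth_functions A"
  defines "\<alpha> \<equiv> field_scale u (ext_d A (fun_form b))"
  shows "wedge A \<alpha> (ext_d A \<alpha>) = field_zero"
proof
  fix Xs :: "('a vfield) list"
  have \<alpha>0: "\<alpha> Xs = (\<lambda>_. 0)" if "length Xs \<noteq> 1" for Xs
    using that by (simp add: \<alpha>_def field_scale_def ext_d_fun_form)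
  have \<alpha>1: "\<alpha> [X] = (\<lambda>x. u x * X b x)" if "X \<in> vector_fields A" for X
    using that by (simp add: \<alpha>_def field_scale_def ext_d_fun_form)
  \<comment> \<open>The second derivatives of \<open>b\<close> cancel against the bracket term,
    leaving du \<and> db.\<close>
  have d\<alpha>: "ext_d A \<alpha> [X, Y] x = X u x * Y b x - Y u x * X b x"
    if "X \<in> vector_fields A" "Y \<in> vector_fields A" for X Y x
    using that vector_field_smooth[OF that(1) b] vector_field_smooth[OF that(2) b] u
    by (simp add: ext_d_one_form \<alpha>1 vector_fields_bracket vector_field_mult[OF that(1)]
        vector_field_mult[OF that(2)]) (simp add: bracket_def algebra_simps)
  show "wedge A \<alpha> (ext_d A \<alpha>) Xs = field_zero Xs"
  proof (cases "length Xs = 3 \<and> set Xs \<subseteq> vector_fields A")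
    case True
    then obtain X Y Z where "Xs = [X, Y, Z]"
      by (auto simp: length_Suc_conv numeral_3_eq_3)
    then show ?thesis
      using True wedge_one_two[of \<alpha> X A Y Z "ext_d A \<alpha>", OF \<alpha>0]
      by (simp add: \<alpha>1 d\<alpha> field_zero_def fun_eq_iff) (simp add: algebra_simps)
  next
    case False
    have "ext_d A \<alpha> Ys = (\<lambda>_. 0)" if "length Ys \<noteq> 2" for Ys
      by (rule ext_d_eq_0_off_degree[of 1]) (use \<alpha>0 that in simp_all)
    then have "length Xs \<noteq> 3 \<Longrightarrow> wedge A \<alpha> (ext_d A \<alpha>) Xs = (\<lambda>_. 0)"
      by (intro wedge_one_form_eq_0_off_degree[of \<alpha> 2]) (simp_all add: \<alpha>0)
    moreover have "\<not> set Xs \<subseteq> vector_fields A \<Longrightarrow> wedge A \<alpha> (ext_d A \<alpha>) Xs = (\<lambda>_. 0)"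
      by (simp add: wedge_def)
    ultimately show ?thesis using False by (auto simp: field_zero_def)
  qed
qed

section \<open>The clock form and the Bernoulli function\<close>

lemma symmetric_tensorD:
  assumes "symmetric_tensor A E B" "P \<in> E" "Q \<in> E"
  shows symmetric_tensor_smooth: "B P Q \<in> smooth_functions A"
    and symmetric_tensor_commute: "B P Q = B Q P"
    and symmetric_tensor_add: "\<And>R. R \<in> E \<Longrightarrow> B (field_add P Q) R = (\<lambda>x. B P R x + B Q R x)"
    and symmetric_tensor_scale: "\<And>f. f \<in> smooth_functions A \<Longrightarrow>
      B (field_scale f P) Q = (\<lambda>x. f x * B P Q x)"
  using assms unfolding symmetric_tensor_def by blast+

text \<open>Time is frozen: \<open>V\<close> and \<tau> are the velocity and clock form at one
  instant, so the argument lives on the manifold alone. The last two conclusions share the formula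
  for d(s\<tau>) in \<open>d_flat\<close>.\<close>

lemma clock_bernoulli:
  fixes A :: "('m::topological_space, 'n::finite) chart set"
  assumes V: "V \<in> vector_fields A" and \<tau>: "\<tau> \<in> forms A 1" and norm: "\<tau> [V] = (\<lambda>_. 1)"
    and g: "riemannian_metric A g"
    and orth: "\<forall>X\<in>vector_fields A. \<forall>x. \<tau> [X] x = 0 \<longrightarrow> g V X x = 0"
    and int: "wedge A \<tau> (ext_d A \<tau>) = field_zero"
    and b: "b \<in> smooth_functions A"
    and bernoulli: "interior_product A V (ext_d A (flat A g V)) = ext_d A (fun_form b)"
    and const: "V (speed g V) = (\<lambda>_. 0)"
  shows clock_speed_pos: "\<And>x. speed g V x > 0"
    and clock_speed_smooth: "speed g V \<in> smooth_functions A"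
    and clock_alpha_eq: "fluid_alpha A g \<tau> V =
      field_scale (\<lambda>x. 1 / speed g V x) (ext_d A (fun_form b))"
    and clock_ext_d_flat: "ext_d A (flat A g V) = wedge A (flat A g V) (fluid_alpha A g \<tau> V)"
proof -
  define s where "s = speed g V"
  have sym: "symmetric_tensor A (vector_fields A) g"
    using g by (simp add: riemannian_metric_def)
  show s_smooth: "speed g V \<in> smooth_functions A"
    unfolding speed_def by (rule symmetric_tensor_smooth[OF sym V V])
  show s_pos: "speed g V x > 0" for x
  proof -
    \<comment> \<open>Otherwise \<open>V\<close> has the same value at \<open>x\<close> as the field
      0 * V, and pointwise dependence of \<tau> on its argument would turn \<tau>(V) = 1 into
      0.\<close>
    have "\<not> vanishes_at V x"
    proof
      assume "vanishes_at V x"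
      moreover have 0: "field_scale (\<lambda>_. 0) V \<in> vector_fields A"
        by (rule vector_fields_field_scale[OF smooth_functions_const V])
      ultimately have "\<tau> [V] x = \<tau> [field_scale (\<lambda>_. 0) V] x"
        by (intro one_form_local[OF \<tau> V]) (simp_all add: vanishes_at_def value_at_def field_scale_def)
      then show False
        using one_form_scale[OF \<tau> smooth_functions_const V] by (simp add: norm)
    qed
    then show ?thesis using g V by (simp add: riemannian_metric_def speed_def)
  qed
  have \<tau>0: "\<tau> Xs = (\<lambda>_. 0)" if "length Xs \<noteq> 1" for Xs
    using one_form_off[OF \<tau>] that by simp
  have gV: "g V X x = s x * \<tau> [X] x" if X: "X \<in> vector_fields A" for X x
  proof -
    note \<tau>X = smooth_functions_minus[OF one_form_smooth[OF \<tau> X]]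
    note \<tau>XV = vector_fields_field_scale[OF \<tau>X V]
    \<comment> \<open>Adding \<open>?Y\<close> removes the component of \<open>X\<close> along
      \<open>V\<close>: since \<tau>(V) = 1, the field X - \<tau>(X) V lies in ker \<tau>, and
      orthogonality gives g(V, X) = \<tau>(X) g(V, V).\<close>
    let ?Y = "field_scale (\<lambda>x. - \<tau> [X] x) V"
    have "\<tau> [field_add X ?Y] x = 0"
      using one_form_add[OF \<tau> X \<tau>XV] one_form_scale[OF \<tau> \<tau>X V] by (simp add: norm)
    then have "g V (field_add X ?Y) x = 0"
      using orth vector_fields_field_add[OF X \<tau>XV] by blast
    \<comment> \<open>\<open>symmetric_tensor\<close> states linearity in the first slot, so the
      arguments are swapped before expanding.\<close>
    moreover have "g V (field_add X ?Y) = g (field_add X ?Y) V"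
      by (rule symmetric_tensor_commute[OF sym V vector_fields_field_add[OF X \<tau>XV]])
    moreover have "g (field_add X ?Y) V = (\<lambda>x. g X V x + g ?Y V x)"
      by (rule symmetric_tensor_add[OF sym X \<tau>XV V])
    moreover have "g ?Y V = (\<lambda>x. - \<tau> [X] x * g V V x)"
      by (rule symmetric_tensor_scale[OF sym V V \<tau>X])
    moreover have "g X V = g V X"
      by (rule symmetric_tensor_commute[OF sym X V])
    ultimately show ?thesis by (simp add: s_def speed_def mult.commute)
  qed
  have flat: "flat A g V Xs = (\<lambda>x. s x * \<tau> Xs x)" for Xs
  proof (cases "length Xs = 1 \<and> set Xs \<subseteq> vector_fields A")
    case True
    then obtain X where "Xs = [X]" by (auto simp: length_Suc_conv)
    with True gV show ?thesis by (simp add: flat_def fun_eq_iff)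
  next
    case False
    then show ?thesis using one_form_off[OF \<tau> False] by (auto simp: flat_def)
  qed
  have flat0: "flat A g V Xs = (\<lambda>_. 0)" if "length Xs \<noteq> 1" for Xs
    using that by (simp add: flat \<tau>0)
  \<comment> \<open>The Leibniz rule d(s\<tau>) = ds \<and> \<tau> + s d\<tau>, evaluated on two
    fields.\<close>
  have d_flat: "ext_d A (flat A g V) [X, Y] x =
      X s x * \<tau> [Y] x - Y s x * \<tau> [X] x + s x * ext_d A \<tau> [X, Y] x"
    if "X \<in> vector_fields A" "Y \<in> vector_fields A" for X Y x
    using that s_smooth one_form_smooth[OF \<tau>]
    by (simp add: ext_d_one_form flat s_def[symmetric] vector_field_mult[OF that(1)]
        vector_field_mult[OF that(2)]) (simp add: algebra_simps)
  \<comment> \<open>The two formulas differ by X(\<tau>(V)), the derivative of the constant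
    1.\<close>
  have lie: "lie_derivative A V \<tau> [X] = ext_d A \<tau> [V, X]" if "X \<in> vector_fields A" for X
    using that V by (simp add: lie_derivative_def ext_d_one_form norm vector_field_const[OF that])
  have \<alpha>1: "fluid_alpha A g \<tau> V [X] x = ext_d A \<tau> [V, X] x - X s x / s x"
    if "X \<in> vector_fields A" for X x
    using that vector_field_ln[OF that s_smooth s_pos]
    by (simp add: fluid_alpha_def field_diff_def lie ext_d_fun_form s_def)
  \<comment> \<open>Default values matter here: equality of forms is equality on all lists,
    including inadmissible ones.\<close>
  have lie0: "lie_derivative A V \<tau> Xs = (\<lambda>_. 0)"
    if "\<not> (length Xs = 1 \<and> set Xs \<subseteq> vector_fields A)" for Xs
    using that \<tau>0 vector_field_const[OF V] by (auto simp: lie_derivative_def)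
  have \<alpha>0: "fluid_alpha A g \<tau> V Xs = (\<lambda>_. 0)"
    if "\<not> (length Xs = 1 \<and> set Xs \<subseteq> vector_fields A)" for Xs
    using lie0[OF that] that by (auto simp: fluid_alpha_def field_diff_def ext_d_fun_form)
  show "fluid_alpha A g \<tau> V = field_scale (\<lambda>x. 1 / speed g V x) (ext_d A (fun_form b))"
  proof
    fix Xs
    show "fluid_alpha A g \<tau> V Xs =
        field_scale (\<lambda>x. 1 / speed g V x) (ext_d A (fun_form b)) Xs"
    proof (cases "length Xs = 1 \<and> set Xs \<subseteq> vector_fields A")
      case True
      then obtain X where Xs: "Xs = [X]" and X: "X \<in> vector_fields A"
        by (auto simp: length_Suc_conv)
      have "X b = ext_d A (flat A g V) [V, X]"
        using fun_cong[OF bernoulli, of "[X]"] X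
        by (simp add: interior_product_def ext_d_fun_form)
      \<comment> \<open>Constancy of the speed along \<open>V\<close> removes the term V(s)
        \<tau>(X) of \<open>d_flat\<close>, and \<tau>(V) = 1 simplifies the term in X(s).\<close>
      then have "X b x = s x * ext_d A \<tau> [V, X] x - X s x" for x
        using d_flat[OF V X] const by (simp add: norm s_def)
      then show ?thesis
        using \<alpha>1[OF X] X s_pos
        by (simp add: Xs fun_eq_iff field_scale_def ext_d_fun_form s_def diff_divide_distrib
            less_imp_neq[symmetric])
    next
      case False
      then show ?thesis
        using \<alpha>0[OF False] by (auto simp: field_scale_def ext_d_fun_form)
    qed
  qed
  show "ext_d A (flat A g V) = wedge A (flat A g V) (fluid_alpha A g \<tau> V)"
  proof
    fix Xs
    consider "\<not> set Xs \<subseteq> vector_fields A" | "length Xs \<noteq> 2"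
      | X Y where "Xs = [X, Y]" "X \<in> vector_fields A" "Y \<in> vector_fields A"
      by (cases "length Xs = 2", cases "set Xs \<subseteq> vector_fields A")
        (fastforce simp: length_Suc_conv numeral_2_eq_2)+
    then show "ext_d A (flat A g V) Xs = wedge A (flat A g V) (fluid_alpha A g \<tau> V) Xs"
    proof cases
      case 1
      then show ?thesis by (simp add: ext_d_def wedge_def)
    next
      case 2
      have "ext_d A (flat A g V) Xs = (\<lambda>_. 0)"
        by (rule ext_d_eq_0_off_degree[of 1]) (use flat0 2 in simp_all)
      moreover have "wedge A (flat A g V) (fluid_alpha A g \<tau> V) Xs = (\<lambda>_. 0)"
        by (rule wedge_one_form_eq_0_off_degree[of _ 1]) (use flat0 \<alpha>0 2 in simp_all)
      ultimately show ?thesis by simp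
    next
      case 3
      have "wedge A \<tau> (ext_d A \<tau>) [V, X, Y] x = 0" for x
        by (simp add: int field_zero_def)
      then have d\<tau>: "ext_d A \<tau> [X, Y] x =
          \<tau> [X] x * ext_d A \<tau> [V, Y] x - \<tau> [Y] x * ext_d A \<tau> [V, X] x" for x
        using wedge_one_two[of \<tau> V A X Y "ext_d A \<tau>" x, OF \<tau>0 V 3(2,3)] by (simp add: norm)
      have s0: "s x \<noteq> 0" for x using s_pos[of x] by (simp add: s_def)
      \<comment> \<open>The factor s of the flat form undoes the division in d log s, so these terms
        reproduce ds \<and> \<tau> from \<open>d_flat\<close>; \<open>d\<tau>\<close> accounts for
        the rest.\<close>
      have "wedge A (flat A g V) (fluid_alpha A g \<tau> V) [X, Y] x =
          s x * \<tau> [X] x * (ext_d A \<tau> [V, Y] x - Y s x / s x) -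
          s x * \<tau> [Y] x * (ext_d A \<tau> [V, X] x - X s x / s x)" for x
        using wedge_one_one[of "flat A g V" X A Y, OF flat0 3(2,3)] 3(2,3) by (simp add: flat \<alpha>1)
      then show ?thesis
        using s0 by (simp add: 3 fun_eq_iff d_flat d\<tau>) (simp add: field_simps)
    qed
  qed
qed

section \<open>Triviality of the Godbillon-Vey class of the steady flow\<close>

theorem mainTheorem11:
  fixes A :: "('m::{t2_space, second_countable_topology}, 'n::finite) chart set"
    and T :: "real set"
    and \<mu> :: "'m dform"
    and \<tau> :: "real \<Rightarrow> 'm dform"
    and v :: "real \<Rightarrow> 'm vfield"
    and g :: "'m cotensor2"
    and nabla :: "'m vfield \<Rightarrow> 'm vfield \<Rightarrow> 'm vfield"
    and p :: "real \<Rightarrow> 'm \<Rightarrow> real"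
    and h :: "real \<Rightarrow> 'm cotensor2"
    and \<gamma> :: "real \<Rightarrow> 'm tensor2"
    and b :: "'m \<Rightarrow> real"
  assumes "aristotelian_fluid A T \<mu> \<tau> v g nabla p h \<gamma>"
    and "CARD('n) \<ge> 3"
    and "steady_with_bernoulli A T g v b"
    and "\<And>t. t \<in> T \<Longrightarrow> lie_derivative A (v t) (fun_form (speed g (v t))) = field_zero"
    and "t \<in> T"
  shows "ext_d A (flat A g (v t)) = wedge A (flat A g (v t)) (fluid_alpha A g (\<tau> t) (v t)) \<and>
    fluid_alpha A g (\<tau> t) (v t) =
      field_scale (\<lambda>x. 1 / speed g (v t) x) (ext_d A (fun_form b)) \<and>
    godbillon_vey A g (\<tau> t) (v t) \<in> de_rham A 3 \<and>
    godbillon_vey A g (\<tau> t) (v t) = de_rham_class A 3 field_zero"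
proof -
  interpret aristotelian_fluid A T \<mu> \<tau> v g nabla p h \<gamma> by fact
  have V: "v t \<in> vector_fields A" and \<tau>: "\<tau> t \<in> forms A 1"
    using velocity clock assms(5) by (simp_all add: smooth_family_def)
  \<comment> \<open>An equation of 0-forms becomes an equation of functions on the empty list;
    \<open>const\<close> is extracted in the same way.\<close>
  have norm: "\<tau> t [v t] = (\<lambda>_. 1)"
    using fun_cong[OF clock_normalized[OF assms(5)], of "[]"]
    by (simp add: interior_product_def fun_form_def)
  have const: "v t (speed g (v t)) = (\<lambda>_. 0)"
    using fun_cong[OF assms(4)[OF assms(5)], of "[]"]
    by (simp add: lie_derivative_def fun_form_def field_zero_def)
  have b: "b \<in> smooth_functions A"
    and bernoulli: "interior_product A (v t) (ext_d A (flat A g (v t))) = ext_d A (fun_form b)"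
    using assms(3,5) by (simp_all add: steady_with_bernoulli_def)
  have orth: "\<forall>X\<in>vector_fields A. \<forall>x. \<tau> t [X] x = 0 \<longrightarrow> g (v t) X x = 0"
    using orthogonal[OF assms(5)] by blast
  note facts = V \<tau> norm metric orth integrable[OF assms(5)] b bernoulli const
  \<comment> \<open>Here u = 1 / s, which is smooth because s is smooth and positive
    everywhere.\<close>
  have "wedge A (fluid_alpha A g (\<tau> t) (v t)) (ext_d A (fluid_alpha A g (\<tau> t) (v t))) = field_zero"
    unfolding clock_alpha_eq[OF facts]
    by (intro wedge_ext_d_scaled_differential b smooth_functions_inverse
        clock_speed_smooth[OF facts] clock_speed_pos[OF facts])
  then have gv: "godbillon_vey A g (\<tau> t) (v t) = de_rham_class A 3 field_zero"
    by (simp add: godbillon_vey_def)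
  moreover have "de_rham_class A 3 field_zero \<in> de_rham A 3"
    unfolding de_rham_class_def de_rham_def by (intro quotientI field_zero_closed)
  ultimately show ?thesis
    using clock_ext_d_flat[OF facts] clock_alpha_eq[OF facts] by simp
qed

end
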